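(* For every integer $n \ge 0$, the relation $\Vdash_n$ is a partial ordering on $\{1,\dots,2^n\}$. For every $p \in \{1,\dots,2^n\}$ we have $1 \Vdash_n p$ and $p \Vdash_n 2^n$; that is, $1$ is initial and $2^n$ is final for $\Vdash_n$.
   Context: For $n \ge 0$, the $n$th Laver table is the set $A_n = \{1,\dots,2^n\}$ equipped with the unique binary operation $\triangleright_n$ such that, for all $x,y$, $x \triangleright_n 1 = (x+1) \bmod 2^n$ and $x \triangleright_n (y \triangleright_n 1) = (x \triangleright_n y) \triangleright_n (x \triangleright_n 1)$, where $a \bmod m$ denotes the unique integer in $\{1,\dots,m\}$ congruent to $a$ modulo $m$. (By a known theorem of Laver this operation exists, is unique, and satisfies the left-selfdistributivity law $x \triangleright (y \triangleright z) = (x \triangleright y) \triangleright (x \triangleright z)$.) For $q,r \in A_n$, write $q \Vdash_n r$ if there exists $p \in A_n$ with $p \triangleright_n q = r$. "Partial ordering" means a reflexive, antisymmetric, transitive relation. *)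

theory Defs
  imports Main "HOL-Library.FuncSet" "HOL-Number_Theory.Cong"
begin

definition pmod :: "nat \<Rightarrow> nat \<Rightarrow> nat" (infixl \<open>pmod\<close> 70) where
  "a pmod m = (if a mod m = 0 then m else a mod m)"

lemma pmod_iff:
  assumes "m > 0"
  shows "r = a pmod m \<longleftrightarrow> r \<in> {1..m} \<and> [r = a] (mod m)"
proof (cases "r = m")
  case True
  then show ?thesis using assms mod_less_divisor[OF assms, of a]
    by (auto simp: pmod_def cong_def)
next
  case False
  then show ?thesis using assms mod_less_divisor[OF assms, of a]
    by (auto simp: pmod_def cong_def)
qed

definition laver_carrier :: "nat \<Rightarrow> nat set" where
  "laver_carrier n = {1..2 ^ n}"

definition is_laver_op :: "nat \<Rightarrow> (nat \<Rightarrow> nat \<Rightarrow> nat) \<Rightarrow> bool" where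
  "is_laver_op n f \<longleftrightarrow>
     f \<in> laver_carrier n \<rightarrow>\<^sub>E laver_carrier n \<rightarrow>\<^sub>E laver_carrier n \<and>
     (\<forall>x \<in> laver_carrier n. f x 1 = (x + 1) pmod 2 ^ n) \<and>
     (\<forall>x \<in> laver_carrier n. \<forall>y \<in> laver_carrier n. f x (f y 1) = f (f x y) (f x 1))"

text \<open>
  The extensional function space fixes the values outside the carrier, so that
  uniqueness of the operation on the carrier is uniqueness of the HOL function.
\<close>

definition laver_op :: "nat \<Rightarrow> nat \<Rightarrow> nat \<Rightarrow> nat" where
  "laver_op n = (THE f. is_laver_op n f)"

definition laver_rel :: "nat \<Rightarrow> (nat \<times> nat) set" where
  "laver_rel n = {(q, r). q \<in> laver_carrier n \<and> r \<in> laver_carrier n \<and>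
     (\<exists>p \<in> laver_carrier n. laver_op n p q = r)}"

end

theory Submission
  imports Defs
begin

text \<open>
  Row \<open>x\<close> of the table increases strictly from \<open>x + 1\<close> until it hits the top element and is periodic
  from there on, so the table can be computed by descending recursion on \<open>x\<close>. It is a Laver table
  as soon as the last column is constant. This property passes from size \<open>N\<close> to size \<open>2 N\<close>: modulo
  \<open>N\<close> a row of the large table is a row of the small one, and it can take the value \<open>N\<close> only once
  before it hits \<open>2 N\<close>, so that its period divides twice the period of the small row.

  Transitivity of right divisibility comes from the composition \<open>x \<circ> y = x \<triangleright> (y + 1) - 1\<close>, for which
  \<open>(x \<circ> y) \<triangleright> z = x \<triangleright> (y \<triangleright> z)\<close>. For antisymmetry, projecting to the table of half the size
  \<open>N = 2 ^ n\<close> leaves the case \<open>s \<triangleright> (N + q) = q\<close> with \<open>q \<le> N\<close>, where periodicity gives \<open>s \<triangleright> q = q\<close>. If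
  \<open>e < 2 N\<close> is the largest element with \<open>e \<triangleright> q = q\<close>, then \<open>e \<circ> e\<close> is no larger, which forces
  \<open>e \<triangleright> e = 2 N\<close>. But in the table of size \<open>2 ^ m\<close> this happens only for \<open>e = 2 ^ m - 2 ^ j\<close>; hence
  \<open>N \<le> e < e \<triangleright> q = q\<close>, a contradiction.
\<close>

section \<open>Representatives modulo \<open>m\<close>\<close>

lemma pmod_mem: "0 < m \<Longrightarrow> a pmod m \<in> {1..m}"
  using pmod_iff by blast

lemma pmod_mod [simp]: "a pmod m mod m = a mod m"
  by (simp add: pmod_def)

lemma pmod_cong: "a mod m = b mod m \<Longrightarrow> a pmod m = b pmod m"
  by (simp add: pmod_def)

lemma pmod_eq_self: "a \<in> {1..m} \<Longrightarrow> a pmod m = a"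
  using pmod_iff[of m a a] by simp

lemma pmod_eq_modulus_iff: "0 < m \<Longrightarrow> a pmod m = m \<longleftrightarrow> m dvd a"
  by (metis pmod_def dvd_eq_mod_eq_0 mod_less_divisor less_irrefl)

lemma pmod_pmod_cancel: "k dvd m \<Longrightarrow> a pmod m pmod k = a pmod k"
  by (rule pmod_cong) (metis mod_mod_cancel pmod_mod)

lemma Suc_pmod_pmod: "Suc (a pmod m) pmod m = Suc a pmod m"
  by (rule pmod_cong) (metis mod_Suc_eq pmod_mod)

lemma Suc_modulus_pmod: "0 < m \<Longrightarrow> Suc m pmod m = Suc 0"
  using pmod_cong[of "Suc m" m "Suc 0"] by (simp add: mod_Suc pmod_eq_self)

lemma eq_pmod_or_add_pmod:
  assumes "a \<in> {1..2 * m}"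
  shows "a = a pmod m \<or> a = m + a pmod m"
proof (cases "a \<le> m")
  case False
  then have "a pmod m = (a - m) pmod m"
    by (intro pmod_cong) (simp add: le_mod_geq)
  also have "\<dots> = a - m"
    using False assms by (intro pmod_eq_self) auto
  finally show ?thesis using False by simp
qed (use assms in \<open>simp add: pmod_eq_self\<close>)

section \<open>Rows and their periods\<close>

lemmas lex_nat2_induct = wf_induct_rule
  [OF wf_lex_prod[OF wf_less_than wf_less_than], case_names less]

lemmas lex_nat3_induct = wf_induct_rule
  [OF wf_lex_prod[OF wf_less_than wf_lex_prod[OF wf_less_than wf_less_than]], case_names less]

text \<open>
  The columns are indexed by all naturals, column 0 being identified with column \<open>M\<close>, so that
  periodicity can be stated without reduction. The maximum is always attained by its second
  argument and only serves termination.
\<close>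

function lav :: "nat \<Rightarrow> nat \<Rightarrow> nat \<Rightarrow> nat" where
  "lav M x y = (if M \<le> x then y pmod M
     else case y of 0 \<Rightarrow> M | Suc k \<Rightarrow> lav M (max (Suc x) (lav M x k)) (Suc x))"
  by pat_completeness auto
termination
  by (relation "measures [\<lambda>(M, x, y). M - x, \<lambda>(M, x, y). y]") auto

declare lav.simps [simp del]

abbreviation lav_syntax :: "nat \<Rightarrow> nat \<Rightarrow> nat \<Rightarrow> nat"
    (\<open>(\<open>notation=\<open>mixfix lav\<close>\<close>_ \<triangleright>\<^bsub>_\<^esub> _)\<close> [76, 0, 76] 75) where
  "x \<triangleright>\<^bsub>M\<^esub> y \<equiv> lav M x y"

lemma lav_top: "M \<triangleright>\<^bsub>M\<^esub> y = y pmod M"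
  by (simp add: lav.simps)

lemma lav_0: "x \<le> M \<Longrightarrow> x \<triangleright>\<^bsub>M\<^esub> 0 = M"
  by (simp add: lav.simps pmod_def)

lemma lav_bounds: "x < M \<Longrightarrow> x \<triangleright>\<^bsub>M\<^esub> y \<in> {x<..M}"
proof (induction "(M - x, y)" arbitrary: x y rule: lex_nat2_induct)
  case (less x y)
  show ?case
  proof (cases y)
    case 0
    then show ?thesis using less.prems by (simp add: lav.simps)
  next
    case (Suc k)
    let ?z = "x \<triangleright>\<^bsub>M\<^esub> k"
    have z: "x < ?z" "?z \<le> M" using less.hyps[of x k] less.prems Suc by auto
    then have eq: "x \<triangleright>\<^bsub>M\<^esub> y = ?z \<triangleright>\<^bsub>M\<^esub> Suc x"
      using less.prems Suc by (simp add: lav.simps[of M x "Suc k"] max_absorb2)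
    show ?thesis
    proof (cases "?z = M")
      case True
      then show ?thesis using eq less.prems by (simp add: lav_top pmod_eq_self)
    next
      case False
      then have "?z \<triangleright>\<^bsub>M\<^esub> Suc x \<in> {?z<..M}" using z by (intro less.hyps) auto
      then show ?thesis using eq z by simp
    qed
  qed
qed

lemma lav_greater: "x < M \<Longrightarrow> x < x \<triangleright>\<^bsub>M\<^esub> y"
  using lav_bounds by simp

lemma lav_mem:
  assumes "x \<in> {1..M}"
  shows "x \<triangleright>\<^bsub>M\<^esub> y \<in> {1..M}"
proof (cases "x = M")
  case True
  then show ?thesis using pmod_mem[of M y] assms by (simp add: lav_top)
qed (use assms lav_bounds[of x M y] in auto)

lemma lav_Suc: "x < M \<Longrightarrow> x \<triangleright>\<^bsub>M\<^esub> Suc y = (x \<triangleright>\<^bsub>M\<^esub> y) \<triangleright>\<^bsub>M\<^esub> Suc x"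
  using lav_greater[of x M y] by (simp add: lav.simps[of M x "Suc y"] max_absorb2)

lemma lav_1: "x < M \<Longrightarrow> x \<triangleright>\<^bsub>M\<^esub> Suc 0 = Suc x"
  by (simp add: lav_Suc lav_0 lav_top pmod_eq_self)

lemma lav_add_le_lav_add:
  assumes "x < M" "\<And>k. k < d \<Longrightarrow> x \<triangleright>\<^bsub>M\<^esub> (i + k) \<noteq> M"
  shows "x \<triangleright>\<^bsub>M\<^esub> i + d \<le> x \<triangleright>\<^bsub>M\<^esub> (i + d)"
  using assms(2)
proof (induction d)
  case (Suc d)
  then have "x \<triangleright>\<^bsub>M\<^esub> (i + d) < M" using lav_bounds[OF assms(1), of "i + d"] by force
  from lav_greater[OF this, of "Suc x"] have "x \<triangleright>\<^bsub>M\<^esub> (i + d) < x \<triangleright>\<^bsub>M\<^esub> (i + Suc d)"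
    using assms(1) by (simp add: lav_Suc)
  then show ?case using Suc by force
qed simp

corollary add_le_lav:
  assumes "x < M" "0 < m" "\<And>k. 0 < k \<Longrightarrow> k < m \<Longrightarrow> x \<triangleright>\<^bsub>M\<^esub> k \<noteq> M"
  shows "x + m \<le> x \<triangleright>\<^bsub>M\<^esub> m"
  using lav_add_le_lav_add[of x M "m - 1" 1] assms by (simp add: lav_1)

lemma lav_add:
  assumes "x \<in> {1..M}" "x \<triangleright>\<^bsub>M\<^esub> m = M"
  shows "x \<triangleright>\<^bsub>M\<^esub> (m + k) = x \<triangleright>\<^bsub>M\<^esub> k"
proof (cases "x = M")
  case True
  then have "m mod M = 0"
    using assms by (simp add: lav_top pmod_eq_modulus_iff dvd_imp_mod_0)
  then have "(m + k) pmod M = k pmod M"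
    using mod_add_left_eq[of m M k] by (intro pmod_cong) simp
  then show ?thesis using True by (simp add: lav_top)
next
  case False
  then show ?thesis using assms by (induction k) (simp_all add: lav_0 lav_Suc)
qed

lemma lav_mult_add:
  "x \<in> {1..M} \<Longrightarrow> x \<triangleright>\<^bsub>M\<^esub> m = M \<Longrightarrow> x \<triangleright>\<^bsub>M\<^esub> (c * m + k) = x \<triangleright>\<^bsub>M\<^esub> k"
  by (induction c) (simp_all add: add.assoc lav_add)

definition row_period :: "nat \<Rightarrow> nat \<Rightarrow> nat" where
  "row_period M x = (LEAST m. 0 < m \<and> x \<triangleright>\<^bsub>M\<^esub> m = M)"

lemma
  assumes "x \<in> {1..M}"
  shows row_period_pos: "0 < row_period M x"
    and lav_row_period: "x \<triangleright>\<^bsub>M\<^esub> row_period M x = M"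
proof -
  have "\<exists>m>0. x \<triangleright>\<^bsub>M\<^esub> m = M"
  proof (cases "x = M")
    case True
    then show ?thesis using assms by (intro exI[of _ M]) (simp add: lav_top pmod_eq_self)
  next
    case False
    then have "x < M" using assms by simp
    then show ?thesis using add_le_lav[of x M M] lav_bounds[of x M M] assms by force
  qed
  then have "0 < row_period M x \<and> x \<triangleright>\<^bsub>M\<^esub> row_period M x = M"
    unfolding row_period_def by (rule LeastI_ex)
  then show "0 < row_period M x" "x \<triangleright>\<^bsub>M\<^esub> row_period M x = M" by simp_all
qed

lemma lav_neq_top_below_row_period:
  "0 < k \<Longrightarrow> k < row_period M x \<Longrightarrow> x \<triangleright>\<^bsub>M\<^esub> k \<noteq> M"
  using not_less_Least unfolding row_period_def by blast

lemma lav_eq_top_iff: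
  assumes "x \<in> {1..M}"
  shows "x \<triangleright>\<^bsub>M\<^esub> k = M \<longleftrightarrow> row_period M x dvd k"
proof -
  let ?p = "row_period M x"
  have "x \<triangleright>\<^bsub>M\<^esub> k = x \<triangleright>\<^bsub>M\<^esub> (k mod ?p)"
    using lav_mult_add[OF assms lav_row_period[OF assms], of "k div ?p" "k mod ?p"]
    by (simp only: div_mult_mod_eq)
  moreover have "x \<triangleright>\<^bsub>M\<^esub> (k mod ?p) \<noteq> M" if "k mod ?p \<noteq> 0"
    using that row_period_pos[OF assms] by (intro lav_neq_top_below_row_period) auto
  ultimately show ?thesis using assms by (auto simp: lav_0 dvd_eq_mod_eq_0)
qed

lemma row_period_top:
  assumes "0 < M"
  shows "row_period M M = M"
proof (rule dvd_antisym)
  have "M \<triangleright>\<^bsub>M\<^esub> k = M \<longleftrightarrow> M dvd k" for k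
    using assms by (simp add: lav_top pmod_eq_modulus_iff)
  then show "row_period M M dvd M" "M dvd row_period M M"
    using lav_eq_top_iff[of M M] lav_row_period[of M M] assms by auto
qed

lemma add_row_period_le:
  assumes "x \<in> {1..<M}"
  shows "x + row_period M x \<le> M"
  using add_le_lav[of x M "row_period M x"] lav_neq_top_below_row_period
    row_period_pos[of x M] lav_row_period[of x M] assms by auto

section \<open>Selfdistributivity and composition\<close>

locale laver_table =
  fixes N :: nat
  assumes pos: "0 < N"
    and lav_last: "x \<in> {1..N} \<Longrightarrow> x \<triangleright>\<^bsub>N\<^esub> N = N"
begin

lemma row_period_dvd: "x \<in> {1..N} \<Longrightarrow> row_period N x dvd N"
  using lav_eq_top_iff lav_last by blast

lemma lav_column_cong:
  assumes "x \<in> {1..N}" "y mod N = z mod N"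
  shows "x \<triangleright>\<^bsub>N\<^esub> y = x \<triangleright>\<^bsub>N\<^esub> z"
proof -
  have "x \<triangleright>\<^bsub>N\<^esub> w = x \<triangleright>\<^bsub>N\<^esub> (w mod N)" for w
    using lav_mult_add[OF assms(1) lav_last[OF assms(1)], of "w div N" "w mod N"] by simp
  then show ?thesis using assms(2) by metis
qed

lemma lav_pmod: "x \<in> {1..N} \<Longrightarrow> x \<triangleright>\<^bsub>N\<^esub> (y pmod N) = x \<triangleright>\<^bsub>N\<^esub> y"
  by (rule lav_column_cong) simp_all

lemma lav_one:
  assumes "x \<in> {1..N}"
  shows "x \<triangleright>\<^bsub>N\<^esub> Suc 0 = Suc x pmod N"
proof (cases "x = N")
  case True
  have "Suc 0 \<in> {1..N}" using pos by simp
  then show ?thesis using True by (simp add: lav_top Suc_modulus_pmod pmod_eq_self)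
qed (use assms in \<open>simp add: lav_1 pmod_eq_self\<close>)

lemma lav_step:
  assumes "x \<in> {1..N}"
  shows "x \<triangleright>\<^bsub>N\<^esub> Suc y = (x \<triangleright>\<^bsub>N\<^esub> y) \<triangleright>\<^bsub>N\<^esub> Suc x"
proof (cases "x = N")
  case True
  have "(y pmod N) \<triangleright>\<^bsub>N\<^esub> Suc N = (y pmod N) \<triangleright>\<^bsub>N\<^esub> Suc 0"
    using pmod_mem[OF pos] by (intro lav_column_cong) (auto simp: mod_Suc)
  also have "\<dots> = Suc y pmod N"
    using pmod_mem[OF pos] by (simp only: lav_one Suc_pmod_pmod)
  finally show ?thesis using True by (simp add: lav_top)
qed (use assms in \<open>simp add: lav_Suc\<close>)

lemma lav_selfdistrib:
  assumes "x \<in> {1..N}" "y \<in> {1..N}"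
  shows "x \<triangleright>\<^bsub>N\<^esub> (y \<triangleright>\<^bsub>N\<^esub> z) = (x \<triangleright>\<^bsub>N\<^esub> y) \<triangleright>\<^bsub>N\<^esub> (x \<triangleright>\<^bsub>N\<^esub> z)"
  using assms
proof (induction "(N - x, N - y, z)" arbitrary: x y z rule: lex_nat3_induct)
  case (less x y z)
  note IH = less.hyps and xy = less.prems
  consider (boundary) "x = N \<or> y = N \<or> z = 0" | (Suc) z' where "x < N" "y < N" "z = Suc z'"
    using xy by (cases z) fastforce+
  then show ?case
  proof cases
    case boundary
    then show ?thesis
      using xy lav_mem[of x N] lav_mem[of y N]
      by (elim disjE) (simp_all add: lav_top lav_0 lav_last lav_pmod pmod_eq_self)
  next
    case (Suc z')
    have "x \<triangleright>\<^bsub>N\<^esub> (y \<triangleright>\<^bsub>N\<^esub> z) = x \<triangleright>\<^bsub>N\<^esub> ((y \<triangleright>\<^bsub>N\<^esub> z') \<triangleright>\<^bsub>N\<^esub> Suc y)"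
      using Suc by (simp add: lav_Suc)
    also have "\<dots> = (x \<triangleright>\<^bsub>N\<^esub> (y \<triangleright>\<^bsub>N\<^esub> z')) \<triangleright>\<^bsub>N\<^esub> (x \<triangleright>\<^bsub>N\<^esub> Suc y)"
      using Suc xy lav_bounds[of y N z'] by (intro IH) auto
    also have "x \<triangleright>\<^bsub>N\<^esub> (y \<triangleright>\<^bsub>N\<^esub> z') = (x \<triangleright>\<^bsub>N\<^esub> y) \<triangleright>\<^bsub>N\<^esub> (x \<triangleright>\<^bsub>N\<^esub> z')"
      using Suc xy by (intro IH) auto
    also have "x \<triangleright>\<^bsub>N\<^esub> Suc y = (x \<triangleright>\<^bsub>N\<^esub> y) \<triangleright>\<^bsub>N\<^esub> Suc x"
      using Suc by (simp add: lav_Suc)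
    also have "((x \<triangleright>\<^bsub>N\<^esub> y) \<triangleright>\<^bsub>N\<^esub> (x \<triangleright>\<^bsub>N\<^esub> z')) \<triangleright>\<^bsub>N\<^esub> ((x \<triangleright>\<^bsub>N\<^esub> y) \<triangleright>\<^bsub>N\<^esub> Suc x)
        = (x \<triangleright>\<^bsub>N\<^esub> y) \<triangleright>\<^bsub>N\<^esub> ((x \<triangleright>\<^bsub>N\<^esub> z') \<triangleright>\<^bsub>N\<^esub> Suc x)"
      using Suc xy lav_bounds[of x N y] lav_mem[of x N z'] by (intro IH[symmetric]) auto
    also have "(x \<triangleright>\<^bsub>N\<^esub> z') \<triangleright>\<^bsub>N\<^esub> Suc x = x \<triangleright>\<^bsub>N\<^esub> z"
      using Suc by (simp add: lav_Suc)
    finally show ?thesis .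
  qed
qed

definition lav_comp :: "nat \<Rightarrow> nat \<Rightarrow> nat" where
  "lav_comp x y = (x \<triangleright>\<^bsub>N\<^esub> Suc y - 1) pmod N"

lemma lav_comp_mem: "lav_comp x y \<in> {1..N}"
  unfolding lav_comp_def by (rule pmod_mem[OF pos])

lemma Suc_lav_comp_pmod:
  assumes "x \<in> {1..N}"
  shows "Suc (lav_comp x y) pmod N = x \<triangleright>\<^bsub>N\<^esub> Suc y"
  using lav_mem[OF assms, of "Suc y"] by (simp add: lav_comp_def Suc_pmod_pmod pmod_eq_self)

lemma lav_lav_comp:
  assumes "x \<in> {1..N}" "y \<in> {1..N}"
  shows "lav_comp x y \<triangleright>\<^bsub>N\<^esub> z = x \<triangleright>\<^bsub>N\<^esub> (y \<triangleright>\<^bsub>N\<^esub> z)"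
proof (induction z)
  case 0
  then show ?case using assms lav_comp_mem[of x y] by (simp add: lav_0 lav_last)
next
  case (Suc z)
  let ?u = "lav_comp x y"
  have "?u \<triangleright>\<^bsub>N\<^esub> Suc z = (?u \<triangleright>\<^bsub>N\<^esub> z) \<triangleright>\<^bsub>N\<^esub> Suc ?u"
    by (rule lav_step[OF lav_comp_mem])
  also have "\<dots> = (?u \<triangleright>\<^bsub>N\<^esub> z) \<triangleright>\<^bsub>N\<^esub> (Suc ?u pmod N)"
    by (intro lav_pmod[symmetric] lav_mem lav_comp_mem)
  also have "\<dots> = (x \<triangleright>\<^bsub>N\<^esub> (y \<triangleright>\<^bsub>N\<^esub> z)) \<triangleright>\<^bsub>N\<^esub> (x \<triangleright>\<^bsub>N\<^esub> Suc y)"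
    using Suc assms by (simp only: Suc_lav_comp_pmod)
  also have "\<dots> = x \<triangleright>\<^bsub>N\<^esub> ((y \<triangleright>\<^bsub>N\<^esub> z) \<triangleright>\<^bsub>N\<^esub> Suc y)"
    using assms lav_mem by (intro lav_selfdistrib[symmetric])
  finally show ?case by (simp only: lav_step[OF assms(2)])
qed

lemma fixed_imp_ex_fixed_lav_self_top:
  assumes "s \<in> {1..<N}" "s \<triangleright>\<^bsub>N\<^esub> q = q"
  shows "\<exists>e \<in> {1..<N}. e \<triangleright>\<^bsub>N\<^esub> q = q \<and> e \<triangleright>\<^bsub>N\<^esub> e = N"
proof -
  define S where "S = {s \<in> {1..<N}. s \<triangleright>\<^bsub>N\<^esub> q = q}"
  define e where "e = Max S"
  have S: "finite S" "s \<in> S" using assms by (simp_all add: S_def)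
  then have "e \<in> S" unfolding e_def by (intro Max_in) auto
  then have e: "e \<in> {1..<N}" "e \<triangleright>\<^bsub>N\<^esub> q = q" by (simp_all add: S_def)
  have "e \<triangleright>\<^bsub>N\<^esub> e = N"
  proof (rule ccontr)
    assume "e \<triangleright>\<^bsub>N\<^esub> e \<noteq> N"
    then have "e < e \<triangleright>\<^bsub>N\<^esub> e" "e \<triangleright>\<^bsub>N\<^esub> e < e \<triangleright>\<^bsub>N\<^esub> Suc e" "e \<triangleright>\<^bsub>N\<^esub> Suc e \<le> N"
      using lav_bounds[of e N] lav_add_le_lav_add[of e N 1 e] e by auto
    moreover from this have "lav_comp e e = e \<triangleright>\<^bsub>N\<^esub> Suc e - 1"
      unfolding lav_comp_def by (intro pmod_eq_self) auto
    ultimately have "e < lav_comp e e" "lav_comp e e < N" by linarith+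
    moreover from this have "lav_comp e e \<in> S"
      using lav_lav_comp[of e e q] e by (simp add: S_def)
    ultimately show False using Max_ge[OF S(1)] by (force simp: e_def)
  qed
  then show ?thesis using e by blast
qed

section \<open>Projections and doubling\<close>

lemma lav_projection:
  assumes "N dvd M" "x \<in> {1..M}"
  shows "(x \<triangleright>\<^bsub>M\<^esub> y) pmod N = (x pmod N) \<triangleright>\<^bsub>N\<^esub> y"
  using assms(2)
proof (induction "(M - x, y)" arbitrary: x y rule: lex_nat2_induct)
  case (less x y)
  note IH = less.hyps and x = less.prems
  have M_pmod: "M pmod N = N" using pos assms(1) by (simp add: pmod_eq_modulus_iff)
  have x': "x pmod N \<in> {1..N}" by (rule pmod_mem[OF pos])
  consider (top) "x = M" | (zero) "x < M" "y = 0" | (Suc) y' where "x < M" "y = Suc y'"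
    using x by (cases y) fastforce+
  then show ?case
  proof cases
    case top
    then show ?thesis using M_pmod assms(1) by (simp add: lav_top pmod_pmod_cancel)
  next
    case zero
    then show ?thesis using M_pmod x' by (simp add: lav_0)
  next
    case (Suc y')
    let ?z = "x \<triangleright>\<^bsub>M\<^esub> y'"
    have "(x \<triangleright>\<^bsub>M\<^esub> y) pmod N = (?z \<triangleright>\<^bsub>M\<^esub> Suc x) pmod N"
      using Suc by (simp add: lav_Suc)
    also have "\<dots> = (?z pmod N) \<triangleright>\<^bsub>N\<^esub> Suc x"
      using Suc lav_bounds[of x M y'] by (intro IH) auto
    also have "?z pmod N = (x pmod N) \<triangleright>\<^bsub>N\<^esub> y'"
      using Suc x by (intro IH) auto
    also have "\<dots> \<triangleright>\<^bsub>N\<^esub> Suc x = \<dots> \<triangleright>\<^bsub>N\<^esub> Suc (x pmod N)"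
      using lav_mem[OF x'] by (intro lav_column_cong) (simp_all, metis mod_Suc_eq pmod_mod)
    also have "\<dots> = (x pmod N) \<triangleright>\<^bsub>N\<^esub> y"
      using Suc x' by (simp add: lav_step)
    finally show ?thesis .
  qed
qed

lemma row_period_projection_dvd:
  assumes "N dvd M" "x \<in> {1..M}"
  shows "row_period N (x pmod N) dvd row_period M x"
proof -
  have "M pmod N = N" using assms pos by (auto simp: pmod_eq_modulus_iff)
  then have "(x pmod N) \<triangleright>\<^bsub>N\<^esub> row_period M x = N"
    using lav_projection[OF assms, of "row_period M x"] lav_row_period[OF assms(2)] by simp
  then show ?thesis using lav_eq_top_iff[OF pmod_mem[OF pos]] by blast
qed

lemma lav_double_eq_half_or_top:
  assumes "x \<in> {1..2 * N}" "row_period N (x pmod N) dvd k"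
  shows "x \<triangleright>\<^bsub>2 * N\<^esub> k = N \<or> x \<triangleright>\<^bsub>2 * N\<^esub> k = 2 * N"
proof -
  have "(x \<triangleright>\<^bsub>2 * N\<^esub> k) pmod N = N"
    using lav_projection[of "2 * N" x k] lav_eq_top_iff[OF pmod_mem[OF pos]] assms by simp
  then show ?thesis
    using eq_pmod_or_add_pmod[OF lav_mem[OF assms(1), of k]] unfolding mult_2 by metis
qed

lemma row_period_double_dvd:
  assumes "x \<in> {1..2 * N}"
  shows "row_period (2 * N) x dvd 2 * row_period N (x pmod N)"
proof (cases "x = 2 * N")
  case True
  then show ?thesis using pos by (simp add: row_period_top pmod_eq_modulus_iff[THEN iffD2])
next
  case False
  define p where "p = row_period N (x pmod N)"
  define q where "q = row_period (2 * N) x"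
  have p: "0 < p" and q: "0 < q"
    using row_period_pos[OF pmod_mem[OF pos]] row_period_pos[OF assms]
    by (simp_all add: p_def q_def)
  have half: "x \<triangleright>\<^bsub>2 * N\<^esub> k = N" if "p dvd k" "\<not> q dvd k" for k
    using lav_double_eq_half_or_top[OF assms] lav_eq_top_iff[OF assms] that
    unfolding p_def q_def by blast
  obtain c where c: "q = c * p"
    using row_period_projection_dvd[of "2 * N" x] assms unfolding p_def q_def
    by (auto simp: dvd_def mult.commute)
  have "q dvd 2 * p"
  proof (rule ccontr)
    assume not_dvd: "\<not> q dvd 2 * p"
    have "c \<noteq> 0" "c \<noteq> 1" "c \<noteq> 2" using not_dvd q c by auto
    then have "2 < c" by linarith
    then have less: "2 * p < q" using p c by simp
    have "x \<triangleright>\<^bsub>2 * N\<^esub> k \<noteq> 2 * N" if "0 < k" "k < q" for k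
      using lav_neq_top_below_row_period that unfolding q_def by blast
    then have "x \<triangleright>\<^bsub>2 * N\<^esub> p + p \<le> x \<triangleright>\<^bsub>2 * N\<^esub> (p + p)"
      using less p False assms by (intro lav_add_le_lav_add) auto
    moreover have "x \<triangleright>\<^bsub>2 * N\<^esub> p = N"
      using less p by (intro half) (auto simp: nat_dvd_not_less)
    moreover have "x \<triangleright>\<^bsub>2 * N\<^esub> (p + p) = N"
      using not_dvd by (intro half) (simp_all add: mult_2)
    ultimately show False using p by simp
  qed
  then show ?thesis by (simp add: p_def q_def)
qed

lemma laver_table_double: "laver_table (2 * N)"
proof
  fix x assume x: "x \<in> {1..2 * N}"
  have "2 * row_period N (x pmod N) dvd 2 * N"
    using row_period_dvd[OF pmod_mem[OF pos]] by (rule mult_dvd_mono[OF dvd_refl])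
  then have "row_period (2 * N) x dvd 2 * N"
    by (rule dvd_trans[OF row_period_double_dvd[OF x]])
  then show "x \<triangleright>\<^bsub>2 * N\<^esub> (2 * N) = 2 * N" using lav_eq_top_iff[OF x] by simp
qed (use pos in simp)

end

lemma laver_table_power_of_two: "laver_table (2 ^ n)"
proof (induction n)
  case 0
  show ?case by unfold_locales (auto simp: lav_top pmod_eq_self)
next
  case (Suc n)
  then show ?case by (simp add: laver_table.laver_table_double)
qed

section \<open>Tables of size \<open>2 ^ n\<close>\<close>

lemma row_period_dvd_power_of_two:
  assumes "x \<in> {1..<2 ^ n}" "2 ^ n < x + 2 ^ Suc j"
  shows "row_period (2 ^ n) x dvd 2 ^ j"
proof -
  interpret laver_table "2 ^ n" by (rule laver_table_power_of_two)
  have "row_period (2 ^ n) x dvd 2 ^ n" using assms by (intro row_period_dvd) auto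
  then obtain i where i: "row_period (2 ^ n) x = 2 ^ i"
    using divides_primepow_nat[OF two_is_prime_nat] by blast
  then have "(2 :: nat) ^ i < 2 ^ Suc j"
    using add_row_period_le[OF assms(1)] assms(2) by linarith
  then have "i \<le> j" by (simp only: power_strict_increasing_iff less_Suc_eq_le)
  then show ?thesis unfolding i by (rule le_imp_power_dvd)
qed

lemma lav_top_minus_power:
  assumes "j < n" "1 \<le> y" "y \<le> 2 ^ j"
  shows "(2 ^ n - 2 ^ j) \<triangleright>\<^bsub>2 * 2 ^ n\<^esub> y = 2 ^ n - 2 ^ j + y"
  using assms(2,3)
proof (induction y rule: nat_induct_at_least)
  case base
  have "(2 :: nat) ^ n - 2 ^ j < 2 * 2 ^ n" by (simp add: less_imp_diff_less)
  then show ?case by (simp add: lav_1)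
next
  case (Suc y)
  let ?M = "2 * 2 ^ n :: nat"
  define e :: nat where "e = 2 ^ n - 2 ^ j"
  interpret laver_table "2 ^ n" by (rule laver_table_power_of_two)
  have "(2 :: nat) ^ j < 2 ^ n" using assms(1) by simp
  then have e: "0 < e" "e + 2 ^ j = 2 ^ n" by (simp_all add: e_def)
  have y: "e + y \<in> {1..<2 ^ n}" using e Suc by simp
  obtain i where i: "j = Suc i" using Suc by (cases j) auto
  have "row_period (2 ^ n) (e + y) dvd 2 ^ i"
    using y e Suc.hyps by (intro row_period_dvd_power_of_two) (simp_all add: i)
  then have "2 * row_period (2 ^ n) (e + y) dvd 2 ^ j" by (simp add: i)
  moreover have "row_period ?M (e + y) dvd 2 * row_period (2 ^ n) (e + y)"
    using row_period_double_dvd[of "e + y"] y by (simp add: pmod_eq_self)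
  moreover have "2 ^ j dvd e"
    unfolding e_def using assms(1) by (intro dvd_diff_nat) (simp_all add: le_imp_power_dvd)
  ultimately have "row_period ?M (e + y) dvd e" by (meson dvd_trans)
  then have "(e + y) \<triangleright>\<^bsub>?M\<^esub> e = ?M" using y by (subst lav_eq_top_iff) auto
  then have "(e + y) \<triangleright>\<^bsub>?M\<^esub> Suc e = e + Suc y"
    using lav_add[of "e + y" ?M e 1] y by (simp add: lav_1)
  then show ?case using Suc e by (simp add: lav_Suc flip: e_def)
qed

lemma lav_top_minus_power_self_neq_top:
  assumes "j < n"
  shows "(2 ^ n - 2 ^ j) \<triangleright>\<^bsub>2 * 2 ^ n\<^esub> (2 ^ n - 2 ^ j) \<noteq> 2 * 2 ^ n"
proof
  let ?M = "2 * 2 ^ n :: nat"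
  define e :: nat where "e = 2 ^ n - 2 ^ j"
  assume "(2 ^ n - 2 ^ j) \<triangleright>\<^bsub>?M\<^esub> (2 ^ n - 2 ^ j) = ?M"
  moreover have "(2 :: nat) ^ j < 2 ^ n" using assms by simp
  then have e: "0 < e" "e < 2 ^ n" "2 ^ n - e = 2 ^ j" by (simp_all add: e_def)
  ultimately have "row_period ?M e dvd e" by (simp add: lav_eq_top_iff flip: e_def)
  moreover have "row_period ?M e dvd 2 ^ n"
    using row_period_dvd_power_of_two[of e "Suc n" n] e by simp
  ultimately have "row_period ?M e dvd 2 ^ j" using dvd_diff_nat e(3) by metis
  then have "e \<triangleright>\<^bsub>?M\<^esub> 2 ^ j = ?M" using e by (simp add: lav_eq_top_iff)
  moreover have "e \<triangleright>\<^bsub>?M\<^esub> 2 ^ j = 2 ^ n"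
    using lav_top_minus_power[OF assms, of "2 ^ j"] e by (simp flip: e_def)
  ultimately show False by simp
qed

lemma lav_self_top_imp_top_minus_power:
  assumes "x \<in> {1..<2 ^ n}" "x \<triangleright>\<^bsub>2 ^ n\<^esub> x = 2 ^ n"
  shows "\<exists>j<n. x = 2 ^ n - 2 ^ j"
  using assms
proof (induction n arbitrary: x)
  case (Suc n)
  let ?N = "2 ^ n :: nat"
  interpret laver_table ?N by (rule laver_table_power_of_two)
  show ?case
  proof (cases "x = ?N")
    case True
    then show ?thesis by (intro exI[of _ n]) simp
  next
    case False
    let ?d = "x pmod ?N"
    have d: "?d \<in> {1..?N}" by (rule pmod_mem[OF pos])
    have x: "x = ?d \<or> x = ?N + ?d" using Suc.prems by (intro eq_pmod_or_add_pmod) auto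
    have "?d \<triangleright>\<^bsub>?N\<^esub> ?d = ?d \<triangleright>\<^bsub>?N\<^esub> x" by (rule lav_pmod[OF d])
    also have "\<dots> = (x \<triangleright>\<^bsub>2 * ?N\<^esub> x) pmod ?N"
      using Suc.prems by (intro lav_projection[symmetric]) auto
    also have "\<dots> = ?N" using Suc.prems by (simp add: pmod_eq_modulus_iff)
    finally have "?d \<triangleright>\<^bsub>?N\<^esub> ?d = ?N" .
    moreover have "?d \<in> {1..<?N}" using d x False Suc.prems by auto
    ultimately obtain j where j: "j < n" "?d = ?N - 2 ^ j" using Suc.IH by blast
    then have "x \<noteq> ?d" using lav_top_minus_power_self_neq_top[of j n] Suc.prems by auto
    then have "x = 2 ^ Suc n - 2 ^ j" using x j by simp
    then show ?thesis using j by (intro exI[of _ j]) simp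
  qed
qed simp

lemma fixed_imp_gt_half:
  assumes "s \<in> {1..<2 * 2 ^ n}" "s \<triangleright>\<^bsub>2 * 2 ^ n\<^esub> q = q"
  shows "2 ^ n < q"
proof -
  let ?M = "2 ^ Suc n :: nat"
  interpret laver_table ?M by (rule laver_table_power_of_two)
  obtain e where e: "e \<in> {1..<?M}" "e \<triangleright>\<^bsub>?M\<^esub> q = q" "e \<triangleright>\<^bsub>?M\<^esub> e = ?M"
    using fixed_imp_ex_fixed_lav_self_top[of s q] assms by auto
  then obtain j where "j < Suc n" "e = ?M - 2 ^ j" using lav_self_top_imp_top_minus_power by blast
  moreover from this have "(2 :: nat) ^ j \<le> 2 ^ n" by simp
  ultimately have "2 ^ n \<le> e" unfolding power_Suc by linarith
  also have "e < q" using lav_greater[of e ?M q] e by simp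
  finally show ?thesis .
qed

section \<open>Right divisibility\<close>

definition rdiv_rel :: "nat \<Rightarrow> (nat \<times> nat) set" where
  "rdiv_rel M = {(q, r). q \<in> {1..M} \<and> (\<exists>p \<in> {1..M}. p \<triangleright>\<^bsub>M\<^esub> q = r)}"

lemma rdiv_rel_subset: "rdiv_rel M \<subseteq> {1..M} \<times> {1..M}"
  unfolding rdiv_rel_def using lav_mem by blast

lemma refl_on_rdiv_rel: "refl_on {1..M} (rdiv_rel M)"
proof (rule refl_onI)
  fix q assume "q \<in> {1..M}"
  then show "(q, q) \<in> rdiv_rel M"
    unfolding rdiv_rel_def using pmod_eq_self[of q M] by (auto simp: lav_top intro!: bexI[of _ M])
qed

lemma rdiv_rel_top:
  assumes "p \<in> {1..M}"
  shows "(p, M) \<in> rdiv_rel M"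
proof (cases "M = 1")
  case True
  then show ?thesis using assms refl_on_rdiv_rel[of M] by (auto dest: refl_onD)
next
  case False
  then have M: "M - 1 \<in> {1..<M}" using assms by auto
  then have "(M - 1) \<triangleright>\<^bsub>M\<^esub> p = M" using lav_bounds[of "M - 1" M p] by auto
  then show ?thesis unfolding rdiv_rel_def using assms M by (auto intro!: bexI[of _ "M - 1"])
qed

context laver_table
begin

lemma trans_rdiv_rel: "trans (rdiv_rel N)"
proof (rule transI)
  fix p q r assume "(p, q) \<in> rdiv_rel N" "(q, r) \<in> rdiv_rel N"
  then obtain x y where p: "p \<in> {1..N}" and xy: "x \<in> {1..N}" "y \<in> {1..N}"
    and "y \<triangleright>\<^bsub>N\<^esub> p = q" "x \<triangleright>\<^bsub>N\<^esub> q = r"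
    unfolding rdiv_rel_def by blast
  then have "lav_comp x y \<triangleright>\<^bsub>N\<^esub> p = r" by (simp only: lav_lav_comp)
  then show "(p, r) \<in> rdiv_rel N" unfolding rdiv_rel_def using p lav_comp_mem by blast
qed

lemma one_rdiv_rel:
  assumes "p \<in> {1..N}"
  shows "(1, p) \<in> rdiv_rel N"
proof -
  have "((p - 1) pmod N) \<triangleright>\<^bsub>N\<^esub> Suc 0 = Suc (p - 1) pmod N"
    using pmod_mem[OF pos] by (simp only: lav_one Suc_pmod_pmod)
  also have "\<dots> = p" using assms by (simp add: pmod_eq_self)
  finally show ?thesis unfolding rdiv_rel_def using pmod_mem[OF pos] pos by force
qed

lemma rdiv_rel_projection:
  assumes "N dvd M" "(q, r) \<in> rdiv_rel M"
  shows "(q pmod N, r pmod N) \<in> rdiv_rel N"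
proof -
  obtain p where p: "p \<in> {1..M}" "p \<triangleright>\<^bsub>M\<^esub> q = r"
    using assms(2) unfolding rdiv_rel_def by blast
  then have "(p pmod N) \<triangleright>\<^bsub>N\<^esub> (q pmod N) = r pmod N"
    using lav_projection[OF assms(1) p(1), of q] pmod_mem[OF pos] by (simp only: lav_pmod)
  then show ?thesis unfolding rdiv_rel_def using pmod_mem[OF pos] by blast
qed

end

lemma half_add_not_rdiv_rel:
  assumes "q \<le> 2 ^ n"
  shows "(2 ^ n + q, q) \<notin> rdiv_rel (2 * 2 ^ n)"
proof
  let ?N = "2 ^ n :: nat"
  assume "(?N + q, q) \<in> rdiv_rel (2 * ?N)"
  then obtain s where s: "s \<in> {1..2 * ?N}" "s \<triangleright>\<^bsub>2 * ?N\<^esub> (?N + q) = q"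
    unfolding rdiv_rel_def by auto
  have "s \<noteq> 2 * ?N" using s assms by (auto simp: lav_top pmod_eq_self)
  then have s': "s \<in> {1..<2 * ?N}" using s by simp
  then have "row_period (2 * ?N) s dvd ?N"
    using row_period_dvd_power_of_two[of s "Suc n" n] by simp
  then have "s \<triangleright>\<^bsub>2 * ?N\<^esub> q = q"
    using lav_add[of s "2 * ?N" ?N q] lav_eq_top_iff[OF s(1)] s by simp
  then show False using fixed_imp_gt_half[OF s'] assms by fastforce
qed

lemma antisym_rdiv_rel: "antisym (rdiv_rel (2 ^ n))"
proof (induction n)
  case 0
  then show ?case using rdiv_rel_subset[of 1] by (auto intro!: antisymI)
next
  case (Suc n)
  let ?N = "2 ^ n :: nat"
  interpret laver_table ?N by (rule laver_table_power_of_two)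
  have "antisym (rdiv_rel (2 * ?N))"
  proof (rule antisymI)
    fix q r assume qr: "(q, r) \<in> rdiv_rel (2 * ?N)" "(r, q) \<in> rdiv_rel (2 * ?N)"
    have eq: "q pmod ?N = r pmod ?N"
      using rdiv_rel_projection[OF _ qr(1)] rdiv_rel_projection[OF _ qr(2)]
      by (intro antisymD[OF Suc.IH]) simp_all
    have "q \<in> {1..2 * ?N}" "r \<in> {1..2 * ?N}" using qr rdiv_rel_subset by blast+
    then have "q = q pmod ?N \<or> q = ?N + q pmod ?N" "r = r pmod ?N \<or> r = ?N + r pmod ?N"
      using eq_pmod_or_add_pmod by blast+
    moreover have "(?N + q pmod ?N, q pmod ?N) \<notin> rdiv_rel (2 * ?N)"
      using pmod_mem[OF pos, of q] by (intro half_add_not_rdiv_rel) simp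
    ultimately show "q = r" using qr eq by metis
  qed
  then show ?case by simp
qed

section \<open>The Laver operation\<close>

lemma is_laver_op_1:
  "is_laver_op n g \<Longrightarrow> x \<in> {1..2 ^ n} \<Longrightarrow> g x (Suc 0) = Suc x pmod 2 ^ n"
  by (simp add: is_laver_op_def laver_carrier_def)

lemma is_laver_op_Suc:
  assumes "is_laver_op n g" "x \<in> {1..2 ^ n}" "y \<in> {1..<2 ^ n}"
  shows "g x (Suc y) = g (g x y) (Suc x pmod 2 ^ n)"
proof -
  have "x \<in> laver_carrier n" "y \<in> laver_carrier n"
    using assms by (simp_all add: laver_carrier_def)
  then have "g x (g y 1) = g (g x y) (g x 1)"
    using assms(1) unfolding is_laver_op_def by blast
  moreover have "g y 1 = Suc y"
    using assms is_laver_op_1[of n g y] by (simp add: pmod_eq_self)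
  ultimately show ?thesis using assms by (simp add: is_laver_op_1)
qed

lemma is_laver_op_top:
  assumes "is_laver_op n g" "1 \<le> y" "y \<le> 2 ^ n"
  shows "g (2 ^ n) y = y"
  using assms(2,3)
proof (induction y rule: nat_induct_at_least)
  case base
  then show ?case using is_laver_op_1[OF assms(1), of "2 ^ n"] by (simp add: Suc_modulus_pmod)
next
  case (Suc y)
  then have "g (2 ^ n) (Suc y) = g y (Suc 0)"
    using is_laver_op_Suc[OF assms(1), of "2 ^ n" y] by (simp add: Suc_modulus_pmod)
  also have "\<dots> = Suc y"
    using is_laver_op_1[OF assms(1), of y] Suc by (simp add: pmod_eq_self)
  finally show ?case .
qed

lemma is_laver_op_eq_lav:
  assumes g: "is_laver_op n g" and "x \<in> {1..2 ^ n}" "y \<in> {1..2 ^ n}"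
  shows "g x y = x \<triangleright>\<^bsub>2 ^ n\<^esub> y"
  using assms(2,3)
proof (induction "(2 ^ n - x, y)" arbitrary: x y rule: lex_nat2_induct)
  case (less x y)
  let ?N = "2 ^ n :: nat"
  note IH = less.hyps and xy = less.prems
  consider (top) "x = ?N" | (one) "x < ?N" "y = Suc 0"
    | (Suc) y' where "x < ?N" "y = Suc y'" "0 < y'"
    using xy by (cases y; cases "x = ?N"; cases "y = 1") auto
  then show ?case
  proof cases
    case top
    then show ?thesis using is_laver_op_top[OF g, of y] xy by (simp add: lav_top pmod_eq_self)
  next
    case one
    then show ?thesis using is_laver_op_1[OF g, of x] xy by (simp add: lav_1 pmod_eq_self)
  next
    case (Suc y')
    let ?z = "x \<triangleright>\<^bsub>?N\<^esub> y'"
    have "g x y = g (g x y') (Suc x)"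
      using is_laver_op_Suc[OF g, of x y'] Suc xy by (simp add: pmod_eq_self)
    also have "g x y' = ?z"
      using Suc xy by (intro IH) auto
    also have "g ?z (Suc x) = ?z \<triangleright>\<^bsub>?N\<^esub> Suc x"
      using Suc xy lav_bounds[of x ?N y'] by (intro IH) auto
    also have "\<dots> = x \<triangleright>\<^bsub>?N\<^esub> y" using Suc by (simp add: lav_Suc)
    finally show ?thesis .
  qed
qed

definition restrict_lav :: "nat \<Rightarrow> nat \<Rightarrow> nat \<Rightarrow> nat" where
  "restrict_lav n = (\<lambda>x \<in> {1..2 ^ n}. \<lambda>y \<in> {1..2 ^ n}. x \<triangleright>\<^bsub>2 ^ n\<^esub> y)"

lemma is_laver_op_restrict_lav: "is_laver_op n (restrict_lav n)"
proof -
  let ?N = "2 ^ n :: nat"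
  let ?f = "restrict_lav n"
  interpret laver_table ?N by (rule laver_table_power_of_two)
  have app: "?f x y = x \<triangleright>\<^bsub>?N\<^esub> y" if "x \<in> {1..?N}" "y \<in> {1..?N}" for x y
    using that by (simp add: restrict_lav_def)
  have one: "?f x 1 = (x + 1) pmod ?N" if "x \<in> {1..?N}" for x
    using that lav_one[OF that] by (simp add: app)
  have "?f x (?f y 1) = ?f (?f x y) (?f x 1)"
    if x: "x \<in> {1..?N}" and y: "y \<in> {1..?N}" for x y
  proof -
    have "?f x (?f y 1) = x \<triangleright>\<^bsub>?N\<^esub> Suc y"
      using x by (simp only: one[OF y] app[OF x pmod_mem[OF pos]] lav_pmod) simp
    also have "\<dots> = (x \<triangleright>\<^bsub>?N\<^esub> y) \<triangleright>\<^bsub>?N\<^esub> (Suc x pmod ?N)"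
      using lav_mem[OF x] by (simp only: lav_step[OF x] lav_pmod)
    also have "\<dots> = ?f (?f x y) (?f x 1)"
      using lav_mem[OF x] pmod_mem[OF pos] by (simp only: one[OF x] app[OF x y] app) simp
    finally show ?thesis .
  qed
  moreover have "?f \<in> {1..?N} \<rightarrow>\<^sub>E {1..?N} \<rightarrow>\<^sub>E {1..?N}"
    unfolding restrict_lav_def by (intro restrict_PiE_iff[THEN iffD2] ballI lav_mem)
  ultimately show ?thesis using one by (simp add: is_laver_op_def laver_carrier_def)
qed

lemma is_laver_op_iff: "is_laver_op n g \<longleftrightarrow> g = restrict_lav n"
proof
  assume g: "is_laver_op n g"
  have PiE: "f \<in> laver_carrier n \<rightarrow>\<^sub>E laver_carrier n \<rightarrow>\<^sub>E laver_carrier n"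
    if "is_laver_op n f" for f
    using that by (simp add: is_laver_op_def)
  note PiE_both = PiE[OF g] PiE[OF is_laver_op_restrict_lav]
  show "g = restrict_lav n"
  proof (rule PiE_ext[OF PiE_both])
    fix x assume x: "x \<in> laver_carrier n"
    show "g x = restrict_lav n x"
      by (rule PiE_ext[OF PiE_both[THEN PiE_mem, OF x]])
        (use x in \<open>simp add: laver_carrier_def is_laver_op_eq_lav[OF g]
          is_laver_op_eq_lav[OF is_laver_op_restrict_lav]\<close>)
  qed
qed (simp add: is_laver_op_restrict_lav)

lemma laver_rel_eq_rdiv_rel: "laver_rel n = rdiv_rel (2 ^ n)"
proof -
  have "laver_op n = restrict_lav n" by (simp add: laver_op_def is_laver_op_iff)
  then show ?thesis
    using lav_mem[of _ "2 ^ n"]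
    by (auto simp: laver_rel_def laver_carrier_def rdiv_rel_def restrict_lav_def)
qed

theorem proposition4p2:
  fixes n :: nat
  shows "partial_order_on {1..2 ^ n} (laver_rel n) \<and>
    (\<forall>p \<in> {1..2 ^ n}. (1, p) \<in> laver_rel n \<and> (p, 2 ^ n) \<in> laver_rel n)"
proof -
  interpret laver_table "2 ^ n" by (rule laver_table_power_of_two)
  have "partial_order_on {1..2 ^ n} (rdiv_rel (2 ^ n))"
    unfolding partial_order_on_def preorder_on_def
    using rdiv_rel_subset refl_on_rdiv_rel trans_rdiv_rel antisym_rdiv_rel by blast
  then show ?thesis
    unfolding laver_rel_eq_rdiv_rel using one_rdiv_rel rdiv_rel_top by blast
qed

end
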